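(* Let $M$ be a closed manifold and let $\operatorname{Vect}(M)$ be the set of isomorphism classes of complex (respectively, real) vector bundles over $M$. Suppose that $S\subset \operatorname{Vect}(M)$ satisfies the following properties: (1) $S$ contains all trivial bundles; (2) the Whitney sum of two bundles in $S$ belongs to $S$; (3) every bundle in $S$ has an inverse in $S$. Then the following are equivalent: (i) the natural inclusion $\imath\colon K(S)\to K(M)$ is surjective; (ii) for every vector bundle $E$ over $M$ (complex, respectively real) there exists an integer $k$ (depending on $E$) such that $E\oplus k$ is isomorphic to a bundle in $S$.
   Context: An integer $k\ge 0$ also denotes the trivial bundle of rank $k$ over $M$. A bundle $F$ is an inverse of $E$ if the Whitney sum $E\oplus F$ is isomorphic to a trivial bundle. For a set $S$ of vector bundles over $M$ which contains the trivial bundles and is closed under Whitney sums, its Grothendieck group is $K(S)=\{A-B : A,B\in S\}$ (formal differences), where $A_1-B_1=A_2-B_2$ if and only if there exists $m$ such that $A_1\oplus B_2\oplus m$ and $A_2\oplus B_1\oplus m$ are isomorphic; the group operation is induced by Whitney sum. $K(M)$ denotes the Grothendieck group of $\operatorname{Vect}(M)$ (topological K-theory; in the real case usually denoted $KO(M)$). The map $\imath\colon K(S)\to K(M)$ is the group homomorphism sending $A-B$ to $A-B$, induced by the inclusion $S\subset\operatorname{Vect}(M)$. *)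

theory Defs
  imports "HOL-Analysis.Analysis" "HOL-Algebra.Group"
begin

definition closed_manifold :: "'m topology \<Rightarrow> bool" where
  "closed_manifold M \<longleftrightarrow>
     Hausdorff_space M \<and> second_countable M \<and> compact_space M \<and>
     (\<exists>n. \<forall>x \<in> topspace M. \<exists>U V. openin M U \<and> x \<in> U \<and> openin (Euclidean_space n) V \<and>
        subtopology M U homeomorphic_space subtopology (Euclidean_space n) V)"

section \<open>Vector bundles\<close>

text \<open>The scalars form a type of class \<open>real_normed_field\<close>; the cases of interest are
  \<^typ>\<open>real\<close> and \<^typ>\<open>complex\<close>. The values of the two fibrewise operations are relevant only
  on points of the total space (for the addition, on two points of one fibre).\<close>

record ('e, 'm, 'k) vbundle =
  total_space :: "'e topology"
  bundle_proj :: "'e \<Rightarrow> 'm"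
  fibre_add :: "'e \<Rightarrow> 'e \<Rightarrow> 'e"
  fibre_scale :: "'k \<Rightarrow> 'e \<Rightarrow> 'e"

definition fibre :: "('e, 'm, 'k) vbundle \<Rightarrow> 'm \<Rightarrow> 'e set" where
  "fibre E x = {e \<in> topspace (total_space E). bundle_proj E e = x}"

definition vector_space_structure ::
  "'e set \<Rightarrow> ('e \<Rightarrow> 'e \<Rightarrow> 'e) \<Rightarrow> ('k::field \<Rightarrow> 'e \<Rightarrow> 'e) \<Rightarrow> bool" where
  "vector_space_structure V add scl \<longleftrightarrow>
     (\<forall>u\<in>V. \<forall>v\<in>V. add u v \<in> V \<and> add u v = add v u) \<and>
     (\<forall>u\<in>V. \<forall>v\<in>V. \<forall>w\<in>V. add (add u v) w = add u (add v w)) \<and>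
     (\<exists>z\<in>V. (\<forall>v\<in>V. add v z = v) \<and> (\<forall>v\<in>V. \<exists>w\<in>V. add v w = z)) \<and>
     (\<forall>c. \<forall>v\<in>V. scl c v \<in> V) \<and>
     (\<forall>c. \<forall>u\<in>V. \<forall>v\<in>V. scl c (add u v) = add (scl c u) (scl c v)) \<and>
     (\<forall>c d. \<forall>v\<in>V. scl (c + d) v = add (scl c v) (scl d v)) \<and>
     (\<forall>c d. \<forall>v\<in>V. scl (c * d) v = scl c (scl d v)) \<and>
     (\<forall>v\<in>V. scl 1 v = v)"

definition bundle_iso_map ::
  "('e, 'm, 'k) vbundle \<Rightarrow> ('f, 'm, 'k) vbundle \<Rightarrow> ('e \<Rightarrow> 'f) \<Rightarrow> bool" where
  "bundle_iso_map E F h \<longleftrightarrow>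
     homeomorphic_map (total_space E) (total_space F) h \<and>
     (\<forall>e \<in> topspace (total_space E). bundle_proj F (h e) = bundle_proj E e) \<and>
     (\<forall>e \<in> topspace (total_space E). \<forall>e' \<in> topspace (total_space E).
        bundle_proj E e = bundle_proj E e' \<longrightarrow>
        h (fibre_add E e e') = fibre_add F (h e) (h e')) \<and>
     (\<forall>c. \<forall>e \<in> topspace (total_space E). h (fibre_scale E c e) = fibre_scale F c (h e))"

definition bundle_isomorphic ::
  "('e, 'm, 'k) vbundle \<Rightarrow> ('f, 'm, 'k) vbundle \<Rightarrow> bool" (infix \<open>\<cong>\<^sub>V\<close> 50) where
  "E \<cong>\<^sub>V F \<longleftrightarrow> (\<exists>h. bundle_iso_map E F h)"

text \<open>As in \<^const>\<open>Euclidean_space\<close>, \<open>k\<^sup>n\<close> consists of the sequences that vanish from index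
  \<open>n\<close> on.\<close>

definition coordinate_space :: "nat \<Rightarrow> (nat \<Rightarrow> 'k::real_normed_field) topology" where
  "coordinate_space n =
     subtopology (product_topology (\<lambda>_. euclidean) UNIV) {v. \<forall>i\<ge>n. v i = 0}"

definition trivial_bundle ::
  "'m topology \<Rightarrow> nat \<Rightarrow> ('m \<times> (nat \<Rightarrow> 'k), 'm, 'k::real_normed_field) vbundle" where
  "trivial_bundle M n =
     \<lparr>total_space = prod_topology M (coordinate_space n),
      bundle_proj = fst,
      fibre_add = (\<lambda>(x, u) (y, v). (x, \<lambda>i. u i + v i)),
      fibre_scale = (\<lambda>c (x, u). (x, \<lambda>i. c * u i))\<rparr>"

definition restrict_bundle :: "('e, 'm, 'k) vbundle \<Rightarrow> 'm set \<Rightarrow> ('e, 'm, 'k) vbundle" where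
  "restrict_bundle E U =
     E\<lparr>total_space := subtopology (total_space E) {e. bundle_proj E e \<in> U}\<rparr>"

text \<open>The rank is locally constant, but may differ between components of the base.\<close>

definition vector_bundle ::
  "'m topology \<Rightarrow> ('e, 'm, 'k::real_normed_field) vbundle \<Rightarrow> bool" where
  "vector_bundle M E \<longleftrightarrow>
     continuous_map (total_space E) M (bundle_proj E) \<and>
     (\<forall>x \<in> topspace M. vector_space_structure (fibre E x) (fibre_add E) (fibre_scale E)) \<and>
     (\<forall>x \<in> topspace M. \<exists>U n. openin M U \<and> x \<in> U \<and>
        restrict_bundle E U \<cong>\<^sub>V trivial_bundle (subtopology M U) n)"

definition whitney_sum ::
  "('e, 'm, 'k) vbundle \<Rightarrow> ('f, 'm, 'k) vbundle \<Rightarrow> ('e \<times> 'f, 'm, 'k) vbundle"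
  (infixl \<open>\<oplus>\<^sub>V\<close> 65) where
  "E \<oplus>\<^sub>V F =
     \<lparr>total_space = subtopology (prod_topology (total_space E) (total_space F))
        {(e, f). bundle_proj E e = bundle_proj F f},
      bundle_proj = (\<lambda>(e, f). bundle_proj E e),
      fibre_add = (\<lambda>(e, f) (e', f'). (fibre_add E e e', fibre_add F f f')),
      fibre_scale = (\<lambda>c (e, f). (fibre_scale E c e, fibre_scale F c f))\<rparr>"

section \<open>Isomorphism classes\<close>

text \<open>A set of isomorphism classes needs one type for all total spaces. The type
  \<open>'m \<times> (nat \<Rightarrow> 'k)\<close> (with arbitrary topologies on its subsets, arbitrary projections and
  arbitrary fibrewise operations) is large enough: by \<open>vector_bundle_has_bundle_rep\<close> below, every
  vector bundle over \<open>M\<close>, whatever the type of its total space, is isomorphic to one of this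
  form.\<close>

type_synonym ('m, 'k) bundle_rep = "('m \<times> (nat \<Rightarrow> 'k), 'm, 'k) vbundle"

definition bundle_class ::
  "'m topology \<Rightarrow> ('e, 'm, 'k::real_normed_field) vbundle \<Rightarrow> ('m, 'k) bundle_rep set" where
  "bundle_class M E = {F. vector_bundle M F \<and> E \<cong>\<^sub>V F}"

definition Vect :: "'m topology \<Rightarrow> ('m, 'k::real_normed_field) bundle_rep set set" where
  "Vect M = {bundle_class M E | E :: ('m, 'k) bundle_rep. vector_bundle M E}"

definition trivial_class ::
  "'m topology \<Rightarrow> nat \<Rightarrow> ('m, 'k::real_normed_field) bundle_rep set" where
  "trivial_class M n = bundle_class M (trivial_bundle M n :: ('m, 'k) bundle_rep)"

definition class_sum ::
  "'m topology \<Rightarrow> ('m, 'k::real_normed_field) bundle_rep set \<Rightarrow> ('m, 'k) bundle_rep set \<Rightarrow>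
   ('m, 'k) bundle_rep set" where
  "class_sum M a b = (\<Union>E\<in>a. \<Union>F\<in>b. bundle_class M (E \<oplus>\<^sub>V F))"

lemma bundle_iso_map_trans:
  assumes "bundle_iso_map E F h" "bundle_iso_map F G k"
  shows "bundle_iso_map E G (k \<circ> h)"
proof -
  have "h e \<in> topspace (total_space F)" if "e \<in> topspace (total_space E)" for e
    using that assms(1) homeomorphic_imp_surjective_map
    by (fastforce simp: bundle_iso_map_def)
  with assms show ?thesis
    by (auto simp: bundle_iso_map_def intro: homeomorphic_map_compose)
qed

definition fibre_closed :: "('e, 'm, 'k) vbundle \<Rightarrow> bool" where
  "fibre_closed E \<longleftrightarrow>
     (\<forall>x. \<forall>u\<in>fibre E x. \<forall>v\<in>fibre E x. fibre_add E u v \<in> fibre E x) \<and>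
     (\<forall>c x. \<forall>u\<in>fibre E x. fibre_scale E c u \<in> fibre E x)"

lemma vector_bundle_fibre_closed:
  assumes "vector_bundle M E"
  shows "fibre_closed E"
proof -
  have "x \<in> topspace M" if "u \<in> fibre E x" for u x
    using assms that by (auto simp: vector_bundle_def fibre_def continuous_map_def)
  with assms show ?thesis
    by (auto simp: vector_bundle_def fibre_closed_def vector_space_structure_def)
qed

lemma bundle_iso_map_sym:
  assumes h: "bundle_iso_map E F h" and cl: "fibre_closed E"
  obtains g where "bundle_iso_map F E g" "homeomorphic_maps (total_space E) (total_space F) h g"
proof -
  obtain g where g: "homeomorphic_maps (total_space E) (total_space F) h g"
    using h by (auto simp: bundle_iso_map_def homeomorphic_map_maps)
  have gE: "g f \<in> topspace (total_space E)" and hg: "h (g f) = f"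
    if "f \<in> topspace (total_space F)" for f
    using that g by (auto simp: homeomorphic_maps_def continuous_map_def)
  have gh: "g (h e) = e" if "e \<in> topspace (total_space E)" for e
    using that g by (auto simp: homeomorphic_maps_def)
  have pr: "bundle_proj E (g f) = bundle_proj F f" if "f \<in> topspace (total_space F)" for f
    using h gE[OF that] hg[OF that] by (metis bundle_iso_map_def)
  have "g (fibre_add F f f') = fibre_add E (g f) (g f')"
    if "f \<in> topspace (total_space F)" "f' \<in> topspace (total_space F)"
      "bundle_proj F f = bundle_proj F f'" for f f'
  proof -
    have "fibre_add E (g f) (g f') \<in> topspace (total_space E)"
      using that gE pr cl by (fastforce simp: fibre_closed_def fibre_def)
    moreover have "h (fibre_add E (g f) (g f')) = fibre_add F f f'"
      using that gE pr hg h by (simp add: bundle_iso_map_def)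
    ultimately show ?thesis using gh by metis
  qed
  moreover have "g (fibre_scale F c f) = fibre_scale E c (g f)"
    if "f \<in> topspace (total_space F)" for c f
  proof -
    have "fibre_scale E c (g f) \<in> topspace (total_space E)"
      using that gE cl by (fastforce simp: fibre_closed_def fibre_def)
    moreover have "h (fibre_scale E c (g f)) = fibre_scale F c f"
      using that gE hg h by (simp add: bundle_iso_map_def)
    ultimately show ?thesis using gh by metis
  qed
  moreover have "homeomorphic_map (total_space F) (total_space E) g"
    using g homeomorphic_maps_map homeomorphic_maps_sym by metis
  ultimately have "bundle_iso_map F E g"
    using pr by (auto simp: bundle_iso_map_def)
  with g that show thesis by blast
qed

lemma vector_space_structure_image:
  assumes V: "vector_space_structure V a s"
    and add: "\<And>u v. u \<in> V \<Longrightarrow> v \<in> V \<Longrightarrow> h (a u v) = a' (h u) (h v)"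
    and scl: "\<And>c u. u \<in> V \<Longrightarrow> h (s c u) = s' c (h u)"
  shows "vector_space_structure (h ` V) a' s'"
proof -
  have add_cl: "a u v \<in> V" and comm: "a u v = a v u" if "u \<in> V" "v \<in> V" for u v
    using V that by (auto simp: vector_space_structure_def)
  have scl_cl: "s c v \<in> V" and one: "s 1 v = v"
    and scl_add: "s (c + d) v = a (s c v) (s d v)"
    and scl_scl: "s (c * d) v = s c (s d v)" if "v \<in> V" for c d v
    using V that by (auto simp: vector_space_structure_def)
  have assoc: "a (a u v) w = a u (a v w)" if "u \<in> V" "v \<in> V" "w \<in> V" for u v w
    using V that by (auto simp: vector_space_structure_def)
  have add_scl: "s c (a u v) = a (s c u) (s c v)" if "u \<in> V" "v \<in> V" for c u v
    using V that by (auto simp: vector_space_structure_def)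
  obtain z where z: "z \<in> V" "\<And>v. v \<in> V \<Longrightarrow> a v z = v" "\<And>v. v \<in> V \<Longrightarrow> \<exists>w\<in>V. a v w = z"
    using V by (auto simp: vector_space_structure_def)
  have 1: "a' (h u) (h v) \<in> h ` V \<and> a' (h u) (h v) = a' (h v) (h u)" if "u \<in> V" "v \<in> V" for u v
    using that by (simp add: add_cl comm flip: add)
  have 2: "a' (a' (h u) (h v)) (h w) = a' (h u) (a' (h v) (h w))"
    if "u \<in> V" "v \<in> V" "w \<in> V" for u v w
    using that by (simp add: add_cl assoc flip: add)
  have 3: "a' (h v) (h z) = h v" if "v \<in> V" for v
    using that z by (simp flip: add)
  have 4: "\<exists>w\<in>V. a' (h v) (h w) = h z" if "v \<in> V" for v
    using that z by (metis add)
  have 5: "s' c (h v) \<in> h ` V" if "v \<in> V" for c v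
    using that by (simp add: scl_cl flip: scl)
  have 6: "s' c (a' (h u) (h v)) = a' (s' c (h u)) (s' c (h v))" if "u \<in> V" "v \<in> V" for c u v
    using that by (simp add: add_cl scl_cl add_scl flip: add scl)
  have 7: "s' (c + d) (h v) = a' (s' c (h v)) (s' d (h v))" if "v \<in> V" for c d v
    using that by (simp add: scl_cl scl_add flip: add scl)
  have 8: "s' (c * d) (h v) = s' c (s' d (h v))" if "v \<in> V" for c d v
    using that by (simp add: scl_cl scl_scl flip: scl)
  have 9: "s' 1 (h v) = h v" if "v \<in> V" for v
    using that by (simp add: one flip: scl)
  have "\<exists>z\<in>h ` V. (\<forall>v\<in>h ` V. a' v z = v) \<and> (\<forall>v\<in>h ` V. \<exists>w\<in>h ` V. a' v w = z)"
    using 3 4 z(1) by (intro bexI[of _ "h z"]) auto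
  then show ?thesis
    unfolding vector_space_structure_def using 1 2 5 6 7 8 9 by auto
qed

lemma bundle_iso_map_restrict:
  assumes h: "bundle_iso_map E F h"
  shows "bundle_iso_map (restrict_bundle E U) (restrict_bundle F U) h"
proof -
  have "h ` (topspace (total_space E) \<inter> {e. bundle_proj E e \<in> U}) =
        topspace (total_space F) \<inter> {e. bundle_proj F e \<in> U}"
    using h homeomorphic_imp_surjective_map by (fastforce simp: bundle_iso_map_def)
  then have "homeomorphic_map (subtopology (total_space E) {e. bundle_proj E e \<in> U})
      (subtopology (total_space F) {e. bundle_proj F e \<in> U}) h"
    using h by (intro homeomorphic_map_subtopologies) (auto simp: bundle_iso_map_def)
  with h show ?thesis
    by (simp add: bundle_iso_map_def restrict_bundle_def)
qed

lemma fibre_closed_restrict: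
  assumes "fibre_closed E"
  shows "fibre_closed (restrict_bundle E U)"
  using assms by (auto simp: fibre_closed_def fibre_def restrict_bundle_def)

lemma vector_bundle_iso:
  fixes E :: "('e, 'm, 'k::real_normed_field) vbundle"
  assumes E: "vector_bundle M E" and h: "bundle_iso_map E F h"
  shows "vector_bundle M F"
proof -
  note cl = vector_bundle_fibre_closed[OF E]
  obtain g where g: "bundle_iso_map F E g"
    using bundle_iso_map_sym[OF h cl] by metis
  have "continuous_map (total_space F) M (bundle_proj E \<circ> g)"
    using E g homeomorphic_imp_continuous_map continuous_map_compose
    unfolding vector_bundle_def bundle_iso_map_def by blast
  then have "continuous_map (total_space F) M (bundle_proj F)"
    by (rule continuous_map_eq) (use g in \<open>simp add: bundle_iso_map_def\<close>)
  moreover have "vector_space_structure (fibre F x) (fibre_add F) (fibre_scale F)"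
    if "x \<in> topspace M" for x
  proof -
    have "fibre F x = h ` fibre E x"
      using h homeomorphic_imp_surjective_map by (fastforce simp: bundle_iso_map_def fibre_def)
    moreover have "vector_space_structure (h ` fibre E x) (fibre_add F) (fibre_scale F)"
      using E h that by (intro vector_space_structure_image[of _ "fibre_add E" "fibre_scale E"])
        (auto simp: vector_bundle_def bundle_iso_map_def fibre_def)
    ultimately show ?thesis by simp
  qed
  moreover have "\<exists>U n. openin M U \<and> x \<in> U \<and>
      restrict_bundle F U \<cong>\<^sub>V trivial_bundle (subtopology M U) n"
    if x: "x \<in> topspace M" for x
  proof -
    obtain U n where U: "openin M U" "x \<in> U"
      and "restrict_bundle E U \<cong>\<^sub>V (trivial_bundle (subtopology M U) n :: ('m, 'k) bundle_rep)"
      using E x unfolding vector_bundle_def by blast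
    from this(3) obtain k where
      "bundle_iso_map (restrict_bundle E U) (trivial_bundle (subtopology M U) n) k"
      unfolding bundle_isomorphic_def by blast
    then have "restrict_bundle F U \<cong>\<^sub>V trivial_bundle (subtopology M U) n"
      using bundle_iso_map_trans[OF bundle_iso_map_restrict[OF g]]
      unfolding bundle_isomorphic_def by blast
    with U show ?thesis by blast
  qed
  ultimately show ?thesis by (simp add: vector_bundle_def)
qed

theorem vector_bundle_has_bundle_rep:
  fixes E :: "('e, 'm, 'k::real_normed_field) vbundle"
  assumes E: "vector_bundle M E"
  shows "\<exists>F :: ('m, 'k) bundle_rep. vector_bundle M F \<and> E \<cong>\<^sub>V F"
proof -
  let ?T = "topspace (total_space E)"
  have "\<exists>h :: 'e \<Rightarrow> (nat \<Rightarrow> 'k). inj_on h (fibre E x)" if x: "x \<in> topspace M" for x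
  proof -
    obtain U n and h :: "'e \<Rightarrow> 'm \<times> (nat \<Rightarrow> 'k)" where "x \<in> U"
      and h: "bundle_iso_map (restrict_bundle E U) (trivial_bundle (subtopology M U) n) h"
      using E x unfolding vector_bundle_def bundle_isomorphic_def by blast
    have "inj_on h (topspace (total_space (restrict_bundle E U)))"
      using h homeomorphic_imp_injective_map unfolding bundle_iso_map_def by metis
    moreover have "fibre E x \<subseteq> topspace (total_space (restrict_bundle E U))"
      using \<open>x \<in> U\<close> by (auto simp: restrict_bundle_def fibre_def)
    ultimately have "inj_on h (fibre E x)" using inj_on_subset by blast
    moreover have "fst (h e) = x" if "e \<in> fibre E x" for e
      using h that \<open>x \<in> U\<close>
      by (auto simp: bundle_iso_map_def restrict_bundle_def fibre_def trivial_bundle_def)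
    ultimately have "inj_on (snd \<circ> h) (fibre E x)"
      by (auto simp: inj_on_def prod_eq_iff)
    then show ?thesis by blast
  qed
  then obtain c :: "'m \<Rightarrow> 'e \<Rightarrow> (nat \<Rightarrow> 'k)"
    where c: "\<And>x. x \<in> topspace M \<Longrightarrow> inj_on (c x) (fibre E x)" by metis
  define f where "f e = (bundle_proj E e, c (bundle_proj E e) e)" for e
  define g where "g = inv_into ?T f"
  have "bundle_proj E e \<in> topspace M" if "e \<in> ?T" for e
    using E that by (auto simp: vector_bundle_def continuous_map_def)
  then have inj: "inj_on f ?T"
    unfolding inj_on_def f_def by (auto simp: fibre_def intro!: inj_onD[OF c])
  have gf: "g (f e) = e" if "e \<in> ?T" for e
    using inj that by (simp add: g_def)
  define T where "T = pullback_topology (f ` ?T) g (total_space E)"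
  have tT: "topspace T = f ` ?T"
    using gf by (auto simp: T_def topspace_pullback_topology)
  have "continuous_map (total_space E) T f"
    unfolding T_def
    by (rule continuous_map_pullback'[OF continuous_map_eq[OF continuous_map_id]]) (auto simp: gf)
  moreover have "continuous_map T (total_space E) g"
    unfolding T_def using continuous_map_pullback[OF continuous_map_id] by (simp add: comp_def)
  ultimately have hom: "homeomorphic_map (total_space E) T f"
    using gf tT by (auto simp: homeomorphic_map_maps homeomorphic_maps_def)
  define F where "F = \<lparr>total_space = T, bundle_proj = bundle_proj E \<circ> g,
    fibre_add = (\<lambda>u v. f (fibre_add E (g u) (g v))),
    fibre_scale = (\<lambda>c u. f (fibre_scale E c (g u)))\<rparr>"
  have "bundle_iso_map E F f"
    using hom gf by (auto simp: bundle_iso_map_def F_def)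
  with vector_bundle_iso[OF E] show ?thesis
    unfolding bundle_isomorphic_def by blast
qed

section \<open>Grothendieck groups\<close>

text \<open>The formal difference \<open>A - B\<close> is represented by the pair \<open>(A, B)\<close>.\<close>

definition difference_rel ::
  "'m topology \<Rightarrow> ('m, 'k::real_normed_field) bundle_rep set set \<Rightarrow>
   (('m, 'k) bundle_rep set \<times> ('m, 'k) bundle_rep set) rel" where
  "difference_rel M S =
     {((a1, b1), (a2, b2)). a1 \<in> S \<and> b1 \<in> S \<and> a2 \<in> S \<and> b2 \<in> S \<and>
        (\<exists>m. class_sum M (class_sum M a1 b2) (trivial_class M m) =
             class_sum M (class_sum M a2 b1) (trivial_class M m))}"

definition K_group ::
  "'m topology \<Rightarrow> ('m, 'k::real_normed_field) bundle_rep set set \<Rightarrow>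
   (('m, 'k) bundle_rep set \<times> ('m, 'k) bundle_rep set) set monoid" where
  "K_group M S =
     \<lparr>carrier = (S \<times> S) // difference_rel M S,
      monoid.mult = (\<lambda>p q. difference_rel M S ``
        {(class_sum M a1 a2, class_sum M b1 b2) | a1 b1 a2 b2. (a1, b1) \<in> p \<and> (a2, b2) \<in> q}),
      one = difference_rel M S `` {(trivial_class M 0, trivial_class M 0)}\<rparr>"

text \<open>The homomorphism \<open>K(S) \<rightarrow> K(M)\<close> sends the class of \<open>(A, B)\<close> in \<open>S \<times> S\<close> to the class of
  \<open>(A, B)\<close> in \<open>Vect M \<times> Vect M\<close>.\<close>

definition K_inclusion ::
  "'m topology \<Rightarrow> (('m, 'k::real_normed_field) bundle_rep set \<times> ('m, 'k) bundle_rep set) set \<Rightarrow>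
   (('m, 'k) bundle_rep set \<times> ('m, 'k) bundle_rep set) set" where
  "K_inclusion M p = difference_rel M (Vect M) `` p"

end

theory Submission
  imports Defs
begin

text \<open>If \<open>E - 0\<close> is the image of \<open>A - B\<close> with \<open>A, B\<close> in \<open>S\<close>, then \<open>E \<oplus> B \<oplus> m\<close> and \<open>A \<oplus> m\<close> are
  isomorphic; adding an inverse of \<open>B\<close> in \<open>S\<close> gives a trivial summand on the left and an element
  of \<open>S\<close> on the right. Conversely, if \<open>A \<oplus> k\<close> and \<open>B \<oplus> l\<close> belong to \<open>S\<close>, then
  \<open>A - B = (A \<oplus> k \<oplus> l) - (B \<oplus> l \<oplus> k)\<close>. The equality of formal differences only cancels trivial
  summands, so its transitivity needs inverses. Here they come from \<open>S\<close>: an inverse of \<open>A \<oplus> k\<close>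
  yields one of \<open>A\<close>.\<close>

section \<open>Isomorphisms and Whitney sums\<close>

lemma bundle_isomorphic_refl: "E \<cong>\<^sub>V E"
proof -
  have "bundle_iso_map E E id" by (simp add: bundle_iso_map_def homeomorphic_map_id)
  then show ?thesis unfolding bundle_isomorphic_def by blast
qed

lemma bundle_isomorphic_trans: "E \<cong>\<^sub>V F \<Longrightarrow> F \<cong>\<^sub>V G \<Longrightarrow> E \<cong>\<^sub>V G"
  unfolding bundle_isomorphic_def using bundle_iso_map_trans by blast

text \<open>The inverse homeomorphism respects the operations because those of \<open>E\<close> keep
  each fibre of \<open>E\<close> invariant; \<open>vector_bundle M E\<close> provides this.\<close>

lemma bundle_isomorphic_sym: "vector_bundle M E \<Longrightarrow> E \<cong>\<^sub>V F \<Longrightarrow> F \<cong>\<^sub>V E"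
  unfolding bundle_isomorphic_def
  by (meson bundle_iso_map_sym vector_bundle_fibre_closed)

lemma topspace_whitney_sum:
  "topspace (total_space (E \<oplus>\<^sub>V F)) =
     {(e, f). e \<in> topspace (total_space E) \<and> f \<in> topspace (total_space F) \<and>
        bundle_proj E e = bundle_proj F f}"
  by (auto simp: whitney_sum_def)

text \<open>Since \<open>h\<close> and \<open>k\<close> commute with the projections, their product
  carries the condition of equal base points to the same condition, so it restricts to a
  homeomorphism of the fibre products.\<close>

lemma whitney_sum_cong:
  assumes "E \<cong>\<^sub>V E'" "F \<cong>\<^sub>V F'"
  shows "E \<oplus>\<^sub>V F \<cong>\<^sub>V E' \<oplus>\<^sub>V F'"
proof -
  obtain h k where h: "bundle_iso_map E E' h" and k: "bundle_iso_map F F' k"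
    using assms unfolding bundle_isomorphic_def by blast
  let ?hk = "\<lambda>(e, f). (h e, k f)"
  have h_img: "h ` topspace (total_space E) = topspace (total_space E')"
    and k_img: "k ` topspace (total_space F) = topspace (total_space F')"
    using h k homeomorphic_imp_surjective_map unfolding bundle_iso_map_def by blast+
  have proj: "bundle_proj E' (h e) = bundle_proj E e" "bundle_proj F' (k f) = bundle_proj F f"
    if "e \<in> topspace (total_space E)" "f \<in> topspace (total_space F)" for e f
    using h k that by (auto simp: bundle_iso_map_def)
  obtain h' k' where "homeomorphic_maps (total_space E) (total_space E') h h'"
    "homeomorphic_maps (total_space F) (total_space F') k k'"
    using h k unfolding bundle_iso_map_def homeomorphic_map_maps by blast
  then have "homeomorphic_maps (prod_topology (total_space E) (total_space F))
      (prod_topology (total_space E') (total_space F')) ?hk (\<lambda>(e, f). (h' e, k' f))"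
    by (simp add: homeomorphic_maps_prod)
  then have "homeomorphic_map (prod_topology (total_space E) (total_space F))
      (prod_topology (total_space E') (total_space F')) ?hk"
    unfolding homeomorphic_map_maps by blast
  moreover have "?hk ` (topspace (prod_topology (total_space E) (total_space F)) \<inter>
        {(e, f). bundle_proj E e = bundle_proj F f}) =
      topspace (prod_topology (total_space E') (total_space F')) \<inter>
        {(e, f). bundle_proj E' e = bundle_proj F' f}"
    by (auto simp: proj image_iff simp flip: h_img k_img)
  ultimately have "homeomorphic_map (total_space (E \<oplus>\<^sub>V F)) (total_space (E' \<oplus>\<^sub>V F')) ?hk"
    by (simp add: whitney_sum_def homeomorphic_map_subtopologies)
  then have "bundle_iso_map (E \<oplus>\<^sub>V F) (E' \<oplus>\<^sub>V F') ?hk"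
    using h k unfolding bundle_iso_map_def topspace_whitney_sum
    by (auto simp: whitney_sum_def)
  then show ?thesis unfolding bundle_isomorphic_def by blast
qed

lemma whitney_sum_commute: "E \<oplus>\<^sub>V F \<cong>\<^sub>V F \<oplus>\<^sub>V E"
proof -
  have "homeomorphic_map (total_space (E \<oplus>\<^sub>V F)) (total_space (F \<oplus>\<^sub>V E)) (\<lambda>(e, f). (f, e))"
    unfolding whitney_sum_def
    by (simp, rule homeomorphic_map_subtopologies[OF homeomorphic_map_swap]) auto
  then have "bundle_iso_map (E \<oplus>\<^sub>V F) (F \<oplus>\<^sub>V E) (\<lambda>(e, f). (f, e))"
    unfolding bundle_iso_map_def topspace_whitney_sum by (auto simp: whitney_sum_def)
  then show ?thesis unfolding bundle_isomorphic_def by blast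
qed

lemma continuous_map_whitney_sum_fst:
  "continuous_map (total_space (E \<oplus>\<^sub>V F)) (total_space E) fst"
  by (simp add: whitney_sum_def continuous_map_from_subtopology continuous_map_fst)

lemma continuous_map_whitney_sum_snd:
  "continuous_map (total_space (E \<oplus>\<^sub>V F)) (total_space F) snd"
  by (simp add: whitney_sum_def continuous_map_from_subtopology continuous_map_snd)

text \<open>The universal property of the fibre product; it lets the maps below be checked one
  component at a time.\<close>

lemma continuous_map_into_whitney_sum:
  assumes "continuous_map X (total_space E) f" "continuous_map X (total_space F) g"
    and "\<And>x. x \<in> topspace X \<Longrightarrow> bundle_proj E (f x) = bundle_proj F (g x)"
  shows "continuous_map X (total_space (E \<oplus>\<^sub>V F)) (\<lambda>x. (f x, g x))"
  using assms by (auto simp: whitney_sum_def continuous_map_in_subtopology continuous_map_paired)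

text \<open>Rebracketing triples is the isomorphism. Its continuity in both directions comes from
  the projections and the universal property, without comparing iterated subspace
  topologies.\<close>

lemma whitney_sum_assoc: "(E \<oplus>\<^sub>V F) \<oplus>\<^sub>V G \<cong>\<^sub>V E \<oplus>\<^sub>V (F \<oplus>\<^sub>V G)"
proof -
  let ?h = "\<lambda>p. (fst (fst p), snd (fst p), snd p)" and ?k = "\<lambda>p. ((fst p, fst (snd p)), snd (snd p))"
  note compose = continuous_map_compose[unfolded comp_def]
  have "homeomorphic_maps (total_space ((E \<oplus>\<^sub>V F) \<oplus>\<^sub>V G)) (total_space (E \<oplus>\<^sub>V (F \<oplus>\<^sub>V G))) ?h ?k"
    unfolding homeomorphic_maps_def
  proof (intro conjI)
    show "continuous_map (total_space ((E \<oplus>\<^sub>V F) \<oplus>\<^sub>V G)) (total_space (E \<oplus>\<^sub>V (F \<oplus>\<^sub>V G))) ?h"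
      by (intro continuous_map_into_whitney_sum compose[OF continuous_map_whitney_sum_fst]
          continuous_map_whitney_sum_fst continuous_map_whitney_sum_snd)
        (auto simp: topspace_whitney_sum, auto simp: whitney_sum_def)
    show "continuous_map (total_space (E \<oplus>\<^sub>V (F \<oplus>\<^sub>V G))) (total_space ((E \<oplus>\<^sub>V F) \<oplus>\<^sub>V G)) ?k"
      by (intro continuous_map_into_whitney_sum compose[OF continuous_map_whitney_sum_snd]
          continuous_map_whitney_sum_fst continuous_map_whitney_sum_snd)
        (auto simp: topspace_whitney_sum, auto simp: whitney_sum_def)
  qed auto
  then have "homeomorphic_map (total_space ((E \<oplus>\<^sub>V F) \<oplus>\<^sub>V G)) (total_space (E \<oplus>\<^sub>V (F \<oplus>\<^sub>V G))) ?h"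
    using homeomorphic_map_maps by blast
  then have "bundle_iso_map ((E \<oplus>\<^sub>V F) \<oplus>\<^sub>V G) (E \<oplus>\<^sub>V (F \<oplus>\<^sub>V G)) ?h"
    unfolding bundle_iso_map_def topspace_whitney_sum by (auto simp: whitney_sum_def)
  then show ?thesis unfolding bundle_isomorphic_def by blast
qed

section \<open>Coordinate spaces and sums of trivial bundles\<close>

lemma topspace_coordinate_space: "topspace (coordinate_space n) = {v. \<forall>i\<ge>n. v i = 0}"
  by (simp add: coordinate_space_def)

text \<open>The topology is that of a subspace of a product, so continuity is coordinatewise and the
  vanishing of the tail is a pointwise condition.\<close>

lemma continuous_map_into_coordinate_space:
  "continuous_map X (coordinate_space n) f \<longleftrightarrow>
     (\<forall>i. continuous_map X euclidean (\<lambda>x. f x i)) \<and> (\<forall>x\<in>topspace X. \<forall>i\<ge>n. f x i = 0)"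
  by (auto simp: coordinate_space_def continuous_map_in_subtopology continuous_map_componentwise_UNIV
      Pi_iff)

lemma continuous_map_coordinate: "continuous_map (coordinate_space n) euclidean (\<lambda>v. v i)"
  unfolding coordinate_space_def
  by (intro continuous_map_from_subtopology continuous_map_product_projection) simp

text \<open>Concatenation of the two coordinate vectors is the isomorphism: the second vector is
  placed behind the first \<open>m\<close> positions.\<close>

lemma trivial_bundle_sum:
  "(trivial_bundle M m :: ('m \<times> (nat \<Rightarrow> 'k::real_normed_field), 'm, 'k) vbundle) \<oplus>\<^sub>V
     trivial_bundle M n \<cong>\<^sub>V trivial_bundle M (m + n)"
proof -
  define E F G :: "('m, 'k) bundle_rep"
    where "E = trivial_bundle M m" and "F = trivial_bundle M n" and "G = trivial_bundle M (m + n)"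
  note defs = E_def F_def G_def trivial_bundle_def
  define h :: "('m \<times> (nat \<Rightarrow> 'k)) \<times> ('m \<times> (nat \<Rightarrow> 'k)) \<Rightarrow> 'm \<times> (nat \<Rightarrow> 'k)"
    where "h = (\<lambda>p. (fst (fst p), \<lambda>i. if i < m then snd (fst p) i else snd (snd p) (i - m)))"
  \<comment> \<open>The inverse of \<open>h\<close> cuts a vector at position \<open>m\<close>. The
    zeros filled in from \<open>m\<close> on are what \<open>coordinate_space m\<close> demands, and
    the shift by \<open>m\<close> undoes the offset in \<open>h\<close>.\<close>
  define k :: "'m \<times> (nat \<Rightarrow> 'k) \<Rightarrow> ('m \<times> (nat \<Rightarrow> 'k)) \<times> ('m \<times> (nat \<Rightarrow> 'k))"
    where "k = (\<lambda>p. ((fst p, \<lambda>i. if i < m then snd p i else 0), (fst p, \<lambda>i. snd p (i + m))))"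
  note compose = continuous_map_compose[unfolded comp_def]
  have base: "continuous_map (total_space (trivial_bundle M l :: ('m, 'k) bundle_rep)) M fst"
    and coord: "continuous_map (total_space (trivial_bundle M l :: ('m, 'k) bundle_rep))
      euclidean (\<lambda>p. snd p i)" for l i
    by (auto simp: trivial_bundle_def continuous_map_fst
        intro: compose[OF continuous_map_snd continuous_map_coordinate])
  have vanish: "snd p i = 0"
    if "p \<in> topspace (total_space (trivial_bundle M l :: ('m, 'k) bundle_rep))" "l \<le> i" for p l i
    using that by (auto simp: trivial_bundle_def topspace_coordinate_space)
  have "homeomorphic_maps (total_space (E \<oplus>\<^sub>V F)) (total_space G) h k"
    unfolding homeomorphic_maps_def
  proof (intro conjI ballI)
    have "continuous_map (total_space (E \<oplus>\<^sub>V F)) M (\<lambda>p. fst (fst p))"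
      unfolding E_def by (rule compose[OF continuous_map_whitney_sum_fst base])
    moreover have "continuous_map (total_space (E \<oplus>\<^sub>V F)) (coordinate_space (m + n))
        (\<lambda>p i. if i < m then snd (fst p) i else snd (snd p) (i - m))"
      unfolding continuous_map_into_coordinate_space
    proof (intro conjI allI ballI impI)
      \<comment> \<open>The test \<open>i < m\<close> does not involve the point, so for fixed
        \<open>i\<close> the map is a single coordinate of one of the two summands.\<close>
      show "continuous_map (total_space (E \<oplus>\<^sub>V F)) euclidean
          (\<lambda>p. if i < m then snd (fst p) i else snd (snd p) (i - m))" for i
        unfolding E_def F_def
        by (cases "i < m") (simp_all add: compose[OF continuous_map_whitney_sum_fst coord]
            compose[OF continuous_map_whitney_sum_snd coord])
      \<comment> \<open>From \<open>m + n \<le> i\<close> follows \<open>n \<le> i - m\<close>, so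
        the second vector is already zero at the shifted index.\<close>
      show "(if i < m then snd (fst p) i else snd (snd p) (i - m)) = 0"
        if "p \<in> topspace (total_space (E \<oplus>\<^sub>V F))" "m + n \<le> i" for p i
        using that vanish[of "snd p" n "i - m"] by (auto simp: topspace_whitney_sum F_def)
    qed
    ultimately show "continuous_map (total_space (E \<oplus>\<^sub>V F)) (total_space G) h"
      by (simp add: h_def G_def trivial_bundle_def continuous_map_paired)
    have "continuous_map (total_space G) (total_space E) (\<lambda>p. (fst p, \<lambda>i. if i < m then snd p i else 0))"
    proof -
      have "continuous_map (total_space G) (coordinate_space m) (\<lambda>p i. if i < m then snd p i else 0)"
        unfolding continuous_map_into_coordinate_space G_def
      proof (intro conjI allI)
        show "continuous_map (total_space (trivial_bundle M (m + n))) euclidean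
          (\<lambda>p. if i < m then snd p i else 0 :: 'k)" for i
          using coord by (cases "i < m") simp_all
      qed auto
      then show ?thesis
        using base by (simp add: E_def G_def trivial_bundle_def continuous_map_paired)
    qed
    moreover have "continuous_map (total_space G) (total_space F) (\<lambda>p. (fst p, \<lambda>i. snd p (i + m)))"
    proof -
      have "continuous_map (total_space G) (coordinate_space n) (\<lambda>p i. snd p (i + m))"
        unfolding continuous_map_into_coordinate_space G_def using coord vanish by auto
      then show ?thesis
        using base by (simp add: F_def G_def trivial_bundle_def continuous_map_paired)
    qed
    ultimately show "continuous_map (total_space G) (total_space (E \<oplus>\<^sub>V F)) k"
      unfolding k_def
      by (rule continuous_map_into_whitney_sum) (simp add: E_def F_def trivial_bundle_def)
    \<comment> \<open>Membership in the Whitney sum matters: \<open>h\<close> keeps only the first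
      base point and drops the first vector from position \<open>m\<close> on, where it
      vanishes.\<close>
    show "k (h p) = p" if "p \<in> topspace (total_space (E \<oplus>\<^sub>V F))" for p
      using that by (auto simp: topspace_whitney_sum defs h_def k_def topspace_coordinate_space
          fun_eq_iff)
    show "h (k p) = p" if "p \<in> topspace (total_space G)" for p
      by (auto simp: h_def k_def prod_eq_iff fun_eq_iff)
  qed
  then have "homeomorphic_map (total_space (E \<oplus>\<^sub>V F)) (total_space G) h"
    using homeomorphic_map_maps by blast
  then have "bundle_iso_map (E \<oplus>\<^sub>V F) G h"
    unfolding bundle_iso_map_def topspace_whitney_sum
    by (auto simp: whitney_sum_def defs h_def fun_eq_iff)
  then show ?thesis unfolding bundle_isomorphic_def E_def F_def G_def by blast
qed

section \<open>Restrictions and vector bundle structure of Whitney sums\<close>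

lemma restrict_restrict_bundle:
  "restrict_bundle (restrict_bundle E U) W = restrict_bundle E (U \<inter> W)"
  by (simp add: restrict_bundle_def subtopology_subtopology Collect_conj_eq)

text \<open>The preimage of \<open>U\<close> is the product of \<open>U\<close> with all vectors,
  and a product of subspaces carries the subspace topology. Having an equality instead of an
  isomorphism allows rewriting with it.\<close>

lemma restrict_trivial_bundle:
  "restrict_bundle (trivial_bundle M n :: ('m \<times> (nat \<Rightarrow> 'k::real_normed_field), 'm, 'k) vbundle) U =
     trivial_bundle (subtopology M U) n"
proof -
  have "{e :: 'm \<times> (nat \<Rightarrow> 'k). fst e \<in> U} = U \<times> UNIV" by auto
  then show ?thesis
    using subtopology_Times[of M "coordinate_space n" U UNIV]
    by (simp add: restrict_bundle_def trivial_bundle_def)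
qed

text \<open>Where the base points agree, one of them lies in \<open>U\<close> exactly when both do;
  thus both sides are the same subspace of the product, and the bundles are equal.\<close>

lemma restrict_whitney_sum:
  "restrict_bundle (E \<oplus>\<^sub>V F) U = restrict_bundle E U \<oplus>\<^sub>V restrict_bundle F U"
proof -
  have "{(e, f). bundle_proj E e = bundle_proj F f} \<inter> {p. bundle_proj (E \<oplus>\<^sub>V F) p \<in> U} =
      ({e. bundle_proj E e \<in> U} \<times> {f. bundle_proj F f \<in> U}) \<inter>
      {(e, f). bundle_proj E e = bundle_proj F f}"
    by (auto simp: whitney_sum_def)
  then show ?thesis
    by (simp add: restrict_bundle_def whitney_sum_def subtopology_subtopology
        subtopology_Times flip: subtopology_Times)
qed

lemma restrict_bundle_cong: "E \<cong>\<^sub>V F \<Longrightarrow> restrict_bundle E U \<cong>\<^sub>V restrict_bundle F U"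
  unfolding bundle_isomorphic_def using bundle_iso_map_restrict by blast

section \<open>Trivial bundles and Whitney sums are vector bundles\<close>

lemma vector_space_structure_coordinates:
  "vector_space_structure {v :: nat \<Rightarrow> 'k::field. \<forall>i\<ge>n. v i = 0}
     (\<lambda>u v i. u i + v i) (\<lambda>c u i. c * u i)"
proof -
  let ?V = "{v :: nat \<Rightarrow> 'k. \<forall>i\<ge>n. v i = 0}"
  have "\<exists>w\<in>?V. (\<lambda>i. v i + w i) = (\<lambda>_. 0)" if "v \<in> ?V" for v
    using that by (intro bexI[of _ "\<lambda>i. - v i"]) auto
  then have "\<exists>z\<in>?V. (\<forall>v\<in>?V. (\<lambda>i. v i + z i) = v) \<and> (\<forall>v\<in>?V. \<exists>w\<in>?V. (\<lambda>i. v i + w i) = z)"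
    by (intro bexI[of _ "\<lambda>_. 0"]) auto
  moreover have "\<forall>u\<in>?V. \<forall>v\<in>?V. (\<lambda>i. u i + v i) \<in> ?V \<and> (\<lambda>i. u i + v i) = (\<lambda>i. v i + u i)"
    by (auto simp: add.commute)
  ultimately show ?thesis
    unfolding vector_space_structure_def by (simp add: algebra_simps)
qed

lemma vector_bundle_trivial:
  "vector_bundle M (trivial_bundle M n :: ('m \<times> (nat \<Rightarrow> 'k::real_normed_field), 'm, 'k) vbundle)"
proof -
  let ?T = "trivial_bundle M n :: ('m, 'k) bundle_rep"
  have "continuous_map (total_space ?T) M (bundle_proj ?T)"
    by (simp add: trivial_bundle_def continuous_map_fst)
  moreover have "vector_space_structure (fibre ?T x) (fibre_add ?T) (fibre_scale ?T)"
    if "x \<in> topspace M" for x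
  proof -
    \<comment> \<open>The fibre is a labelled copy of the coordinate vectors, so the vector space
      structure is transported along \<open>Pair x\<close>.\<close>
    have "fibre ?T x = Pair x ` {v. \<forall>i\<ge>n. v i = 0}"
      using that by (auto simp: fibre_def trivial_bundle_def topspace_coordinate_space)
    then show ?thesis
      by (simp, intro vector_space_structure_image[OF vector_space_structure_coordinates])
        (auto simp: trivial_bundle_def)
  qed
  \<comment> \<open>The whole base serves as trivialising neighbourhood of every point.\<close>
  moreover have "restrict_bundle ?T (topspace M) \<cong>\<^sub>V (trivial_bundle (subtopology M (topspace M)) n
      :: ('m, 'k) bundle_rep)"
    by (simp add: restrict_trivial_bundle bundle_isomorphic_refl)
  ultimately show ?thesis unfolding vector_bundle_def by blast
qed

text \<open>Prepared for the fibres of a Whitney sum, which are products of fibres with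
  componentwise operations.\<close>

lemma vector_space_structure_Times:
  assumes V: "vector_space_structure V a s" and W: "vector_space_structure W b t"
  shows "vector_space_structure (V \<times> W) (\<lambda>(v, w) (v', w'). (a v v', b w w'))
    (\<lambda>c (v, w). (s c v, t c w))"
proof -
  obtain z where z: "z \<in> V" "\<And>v. v \<in> V \<Longrightarrow> a v z = v" "\<And>v. v \<in> V \<Longrightarrow> \<exists>w\<in>V. a v w = z"
    using V by (auto simp: vector_space_structure_def)
  obtain z' where z': "z' \<in> W" "\<And>v. v \<in> W \<Longrightarrow> b v z' = v" "\<And>v. v \<in> W \<Longrightarrow> \<exists>w\<in>W. b v w = z'"
    using W by (auto simp: vector_space_structure_def)
  have add_closed: "a u v \<in> V" and commute: "a u v = a v u" if "u \<in> V" "v \<in> V" for u v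
    using V that by (auto simp: vector_space_structure_def)
  have add_closed': "b u v \<in> W" and commute': "b u v = b v u" if "u \<in> W" "v \<in> W" for u v
    using W that by (auto simp: vector_space_structure_def)
  have assoc: "a (a u v) w = a u (a v w)" if "u \<in> V" "v \<in> V" "w \<in> V" for u v w
    using V that by (auto simp: vector_space_structure_def)
  have assoc': "b (b u v) w = b u (b v w)" if "u \<in> W" "v \<in> W" "w \<in> W" for u v w
    using W that by (auto simp: vector_space_structure_def)
  have scale: "s c v \<in> V" "s (c + d) v = a (s c v) (s d v)" "s (c * d) v = s c (s d v)" "s 1 v = v"
    if "v \<in> V" for c d v
    using V that by (simp_all add: vector_space_structure_def)
  have scale': "t c v \<in> W" "t (c + d) v = b (t c v) (t d v)" "t (c * d) v = t c (t d v)" "t 1 v = v"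
    if "v \<in> W" for c d v
    using W that by (simp_all add: vector_space_structure_def)
  have distrib: "s c (a u v) = a (s c u) (s c v)" if "u \<in> V" "v \<in> V" for c u v
    using V that by (simp add: vector_space_structure_def)
  have distrib': "t c (b u v) = b (t c u) (t c v)" if "u \<in> W" "v \<in> W" for c u v
    using W that by (simp add: vector_space_structure_def)
  let ?add = "\<lambda>(v, w) (v', w'). (a v v', b w w')" and ?scale = "\<lambda>c (v, w). (s c v, t c w)"
  have neutral: "?add p (z, z') = p" if "p \<in> V \<times> W" for p
    using that z(2) z'(2) by auto
  have inverse: "\<exists>q\<in>V \<times> W. ?add p q = (z, z')" if p: "p \<in> V \<times> W" for p
  proof -
    obtain v w where "p = (v, w)" "v \<in> V" "w \<in> W" using p by blast
    moreover obtain v' where "v' \<in> V" "a v v' = z" using z(3)[OF \<open>v \<in> V\<close>] by blast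
    moreover obtain w' where "w' \<in> W" "b w w' = z'" using z'(3)[OF \<open>w \<in> W\<close>] by blast
    ultimately show ?thesis by (intro bexI[of _ "(v', w')"]) auto
  qed
  have ex: "\<exists>z\<in>V \<times> W. (\<forall>p\<in>V \<times> W. ?add p z = p) \<and> (\<forall>p\<in>V \<times> W. \<exists>q\<in>V \<times> W. ?add p q = z)"
    using z(1) z'(1) by (intro bexI[of _ "(z, z')"] conjI ballI neutral inverse SigmaI)
  have add_axioms: "?add p q \<in> V \<times> W" "?add p q = ?add q p" if "p \<in> V \<times> W" "q \<in> V \<times> W" for p q
    using that by (simp_all add: case_prod_unfold mem_Times_iff add_closed add_closed'
        commute[of "fst p"] commute'[of "snd p"])
  have scale_add: "?scale c (?add p q) = ?add (?scale c p) (?scale c q)"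
    if "p \<in> V \<times> W" "q \<in> V \<times> W" for c p q
    using that by (simp add: case_prod_unfold mem_Times_iff distrib distrib')
  have add_assoc: "?add (?add p q) r = ?add p (?add q r)"
    if "p \<in> V \<times> W" "q \<in> V \<times> W" "r \<in> V \<times> W" for p q r
    using that by (simp add: case_prod_unfold mem_Times_iff assoc assoc')
  have scale_axioms: "?scale c p \<in> V \<times> W" "?scale (c + d) p = ?add (?scale c p) (?scale d p)"
    "?scale (c * d) p = ?scale c (?scale d p)" "?scale 1 p = p" if "p \<in> V \<times> W" for c d p
    using that by (simp_all add: case_prod_unfold mem_Times_iff scale scale')
  show ?thesis
    unfolding vector_space_structure_def
    by (intro conjI ballI allI ex; rule add_axioms add_assoc scale_add scale_axioms; assumption)
qed

lemma fibre_whitney_sum: "fibre (E \<oplus>\<^sub>V F) x = fibre E x \<times> fibre F x"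
  by (auto simp: fibre_def whitney_sum_def)

lemma vector_bundle_whitney_sum:
  fixes E :: "('e, 'm, 'k::real_normed_field) vbundle" and F :: "('f, 'm, 'k) vbundle"
  assumes E: "vector_bundle M E" and F: "vector_bundle M F"
  shows "vector_bundle M (E \<oplus>\<^sub>V F)"
proof -
  have "continuous_map (total_space (E \<oplus>\<^sub>V F)) M (bundle_proj E \<circ> fst)"
    using E continuous_map_compose[OF continuous_map_whitney_sum_fst]
    unfolding vector_bundle_def by blast
  then have "continuous_map (total_space (E \<oplus>\<^sub>V F)) M (bundle_proj (E \<oplus>\<^sub>V F))"
    by (simp add: whitney_sum_def comp_def case_prod_unfold)
  moreover have "vector_space_structure (fibre (E \<oplus>\<^sub>V F) x) (fibre_add (E \<oplus>\<^sub>V F)) (fibre_scale (E \<oplus>\<^sub>V F))"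
    if "x \<in> topspace M" for x
    using E F that unfolding fibre_whitney_sum vector_bundle_def
    by (simp add: whitney_sum_def vector_space_structure_Times)
  moreover have "\<exists>U l. openin M U \<and> x \<in> U \<and>
      restrict_bundle (E \<oplus>\<^sub>V F) U \<cong>\<^sub>V (trivial_bundle (subtopology M U) l :: ('m, 'k) bundle_rep)"
    if x: "x \<in> topspace M" for x
  proof -
    obtain U m where U: "openin M U" "x \<in> U"
      and EU: "restrict_bundle E U \<cong>\<^sub>V (trivial_bundle (subtopology M U) m :: ('m, 'k) bundle_rep)"
      using E x unfolding vector_bundle_def by blast
    obtain W n where W: "openin M W" "x \<in> W"
      and FW: "restrict_bundle F W \<cong>\<^sub>V (trivial_bundle (subtopology M W) n :: ('m, 'k) bundle_rep)"
      using F x unfolding vector_bundle_def by blast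
    \<comment> \<open>The two bundles may be trivialised over different neighbourhoods. Both
      trivialisations restrict to the intersection, where the ranks \<open>m\<close> and
      \<open>n\<close> add up.\<close>
    have "restrict_bundle E (U \<inter> W) \<cong>\<^sub>V (trivial_bundle (subtopology M (U \<inter> W)) m :: ('m, 'k) bundle_rep)"
      using restrict_bundle_cong[OF EU, of W]
      by (simp add: restrict_restrict_bundle restrict_trivial_bundle subtopology_subtopology)
    moreover have "restrict_bundle F (U \<inter> W) \<cong>\<^sub>V (trivial_bundle (subtopology M (U \<inter> W)) n :: ('m, 'k) bundle_rep)"
      using restrict_bundle_cong[OF FW, of U]
      by (simp add: restrict_restrict_bundle restrict_trivial_bundle subtopology_subtopology Int_commute)
    ultimately have "restrict_bundle (E \<oplus>\<^sub>V F) (U \<inter> W) \<cong>\<^sub>V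
        (trivial_bundle (subtopology M (U \<inter> W)) (m + n) :: ('m, 'k) bundle_rep)"
      unfolding restrict_whitney_sum
      using bundle_isomorphic_trans[OF whitney_sum_cong trivial_bundle_sum] by blast
    then show ?thesis using U W by blast
  qed
  ultimately show ?thesis by (simp add: vector_bundle_def)
qed

section \<open>The commutative semigroup of isomorphism classes\<close>

text \<open>The total spaces of \<open>E\<close> and \<open>F\<close> may have different types; the
  two classes are comparable because both consist of bundles of type
  \<open>bundle_rep\<close>.\<close>

lemma bundle_class_eq:
  fixes E :: "('e, 'm, 'k::real_normed_field) vbundle" and F :: "('f, 'm, 'k) vbundle"
  assumes "vector_bundle M E" "E \<cong>\<^sub>V F"
  shows "bundle_class M E = bundle_class M F"
proof -
  have "E \<cong>\<^sub>V G \<longleftrightarrow> F \<cong>\<^sub>V G" for G :: "('m, 'k) bundle_rep"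
    using bundle_isomorphic_trans[OF assms(2)]
      bundle_isomorphic_trans[OF bundle_isomorphic_sym[OF assms]] by metis
  then show ?thesis by (simp add: bundle_class_def)
qed

text \<open>\<open>Vect M\<close> is defined by classes of bundles of type
  \<open>bundle_rep\<close>, whereas Whitney sums live on a product type. Passing to an isomorphic
  representative bridges the gap.\<close>

lemma bundle_class_in_Vect:
  fixes E :: "('e, 'm, 'k::real_normed_field) vbundle"
  assumes "vector_bundle M E"
  shows "bundle_class M E \<in> Vect M"
proof -
  obtain F :: "('m, 'k) bundle_rep" where "vector_bundle M F" "E \<cong>\<^sub>V F"
    using vector_bundle_has_bundle_rep[OF assms] by blast
  then show ?thesis using bundle_class_eq[OF assms] unfolding Vect_def by blast
qed

lemma VectE:
  fixes a :: "('m, 'k::real_normed_field) bundle_rep set"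
  assumes "a \<in> Vect M"
  obtains E :: "('m, 'k) bundle_rep" where "vector_bundle M E" "a = bundle_class M E"
  using assms unfolding Vect_def by blast

text \<open>By \<open>whitney_sum_cong\<close> all pairs of representatives contribute the same
  class, so the union defining \<open>class_sum\<close> is constant.\<close>

lemma class_sum_bundle_class:
  fixes E :: "('e, 'm, 'k::real_normed_field) vbundle" and F :: "('f, 'm, 'k) vbundle"
  assumes E: "vector_bundle M E" and F: "vector_bundle M F"
  shows "class_sum M (bundle_class M E) (bundle_class M F) = bundle_class M (E \<oplus>\<^sub>V F)"
proof -
  have eq: "bundle_class M (E' \<oplus>\<^sub>V F') = bundle_class M (E \<oplus>\<^sub>V F)"
    if "E' \<in> bundle_class M E" "F' \<in> bundle_class M F" for E' F'
  proof -
    have "E \<oplus>\<^sub>V F \<cong>\<^sub>V E' \<oplus>\<^sub>V F'"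
      using that by (intro whitney_sum_cong) (simp_all add: bundle_class_def)
    from bundle_class_eq[OF vector_bundle_whitney_sum[OF E F] this] show ?thesis by (rule sym)
  qed
  \<comment> \<open>A union of a constant family is that constant only over a nonempty index
    set.\<close>
  have "bundle_class M E \<noteq> {}" "bundle_class M F \<noteq> {}"
    using vector_bundle_has_bundle_rep[OF E] vector_bundle_has_bundle_rep[OF F]
    unfolding bundle_class_def by blast+
  moreover have "class_sum M (bundle_class M E) (bundle_class M F) =
      (\<Union>_\<in>bundle_class M E. \<Union>_\<in>bundle_class M F. bundle_class M (E \<oplus>\<^sub>V F))"
    unfolding class_sum_def by (rule SUP_cong[OF refl SUP_cong[OF refl eq]])
  ultimately show ?thesis by (simp only: UN_constant if_False)
qed

lemma class_sum_closed: "a \<in> Vect M \<Longrightarrow> b \<in> Vect M \<Longrightarrow> class_sum M a b \<in> Vect M"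
  by (elim VectE) (simp add: class_sum_bundle_class bundle_class_in_Vect vector_bundle_whitney_sum)

lemma class_sum_commute: "a \<in> Vect M \<Longrightarrow> b \<in> Vect M \<Longrightarrow> class_sum M a b = class_sum M b a"
  by (elim VectE)
    (metis class_sum_bundle_class bundle_class_eq[OF vector_bundle_whitney_sum whitney_sum_commute])

lemma class_sum_assoc:
  "a \<in> Vect M \<Longrightarrow> b \<in> Vect M \<Longrightarrow> c \<in> Vect M \<Longrightarrow>
     class_sum M (class_sum M a b) c = class_sum M a (class_sum M b c)"
  by (elim VectE) (simp add: class_sum_bundle_class vector_bundle_whitney_sum
      bundle_class_eq[OF _ whitney_sum_assoc])

lemma class_sum_left_commute:
  "a \<in> Vect M \<Longrightarrow> b \<in> Vect M \<Longrightarrow> c \<in> Vect M \<Longrightarrow>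
     class_sum M a (class_sum M b c) = class_sum M b (class_sum M a c)"
  by (metis class_sum_assoc class_sum_commute)

text \<open>A rewrite system that sorts sums; membership in \<open>Vect M\<close> of all summands
  and partial sums has to be supplied along with it.\<close>

lemmas class_sum_ac = class_sum_assoc class_sum_commute class_sum_left_commute

lemma trivial_class_in_Vect: "trivial_class M n \<in> Vect M"
  by (simp add: trivial_class_def bundle_class_in_Vect vector_bundle_trivial)

lemma class_sum_trivial: "class_sum M (trivial_class M m) (trivial_class M n) = trivial_class M (m + n)"
  by (simp add: trivial_class_def class_sum_bundle_class vector_bundle_trivial
      bundle_class_eq[OF vector_bundle_whitney_sum trivial_bundle_sum])

section \<open>Grothendieck groups\<close>

lemma difference_relI:
  assumes "a \<in> S" "b \<in> S" "c \<in> S" "d \<in> S"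
    and "class_sum M (class_sum M a d) (trivial_class M m) = class_sum M (class_sum M c b) (trivial_class M m)"
  shows "((a, b), (c, d)) \<in> difference_rel M S"
  using assms unfolding difference_rel_def by blast

lemma difference_rel_refl: "a \<in> S \<Longrightarrow> b \<in> S \<Longrightarrow> ((a, b), (a, b)) \<in> difference_rel M S"
  by (rule difference_relI[where m = 0]) auto

lemma difference_rel_mono: "S \<subseteq> T \<Longrightarrow> difference_rel M S \<subseteq> difference_rel M T"
  unfolding difference_rel_def by blast

lemma sym_difference_rel: "sym (difference_rel M S)"
  unfolding sym_def difference_rel_def by (auto simp: eq_commute)

text \<open>Adding the two equations leaves the middle term \<open>d\<close> on both sides. It
  cannot be cancelled directly, but its inverse \<open>d'\<close> turns it into a trivial summand,
  which the relation ignores.\<close>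

lemma difference_rel_trans:
  fixes a b c d e f :: "('m, 'k::real_normed_field) bundle_rep set"
  assumes 1: "((a, b), (c, d)) \<in> difference_rel M (Vect M)"
    and 2: "((c, d), (e, f)) \<in> difference_rel M (Vect M)"
    and inv: "d' \<in> Vect M" "class_sum M d d' = trivial_class M l"
  shows "((a, b), (e, f)) \<in> difference_rel M (Vect M)"
proof -
  let ?t = "trivial_class M :: nat \<Rightarrow> ('m, 'k) bundle_rep set"
  have V: "a \<in> Vect M" "b \<in> Vect M" "c \<in> Vect M" "d \<in> Vect M" "e \<in> Vect M" "f \<in> Vect M"
    using 1 2 unfolding difference_rel_def by auto
  note simps = class_sum_ac V inv(1) class_sum_closed trivial_class_in_Vect
  obtain m where m: "class_sum M (class_sum M a d) (?t m) = class_sum M (class_sum M c b) (?t m)"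
    using 1 unfolding difference_rel_def by auto
  obtain n where n: "class_sum M (class_sum M c f) (?t n) = class_sum M (class_sum M e d) (?t n)"
    using 2 unfolding difference_rel_def by auto
  \<comment> \<open>This \<open>r\<close> gathers the stabilising summands of both equations and the
    inverse of \<open>d\<close>, so that \<open>d\<close> and \<open>r\<close> sum to a trivial
    class.\<close>
  define r where "r = class_sum M (?t m) (class_sum M (?t n) d')"
  have r: "class_sum M d r = ?t (l + (m + n))"
  proof -
    have "class_sum M d r = class_sum M (class_sum M d d') (class_sum M (?t m) (?t n))"
      unfolding r_def by (simp add: simps)
    then show ?thesis by (simp add: inv(2) class_sum_trivial)
  qed
  have "class_sum M (class_sum M a f) (class_sum M d r) =
      class_sum M (class_sum M (class_sum M a d) (?t m)) (class_sum M f (class_sum M (?t n) d'))"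
    unfolding r_def by (simp add: simps)
  \<comment> \<open>The first equation trades \<open>a\<close> and \<open>d\<close> for
    \<open>c\<close> and \<open>b\<close>; regrouping exposes the left side of the second equation,
    which then trades \<open>c\<close> and \<open>f\<close> for \<open>e\<close> and
    \<open>d\<close>.\<close>
  also have "\<dots> = class_sum M (class_sum M (class_sum M c f) (?t n)) (class_sum M b (class_sum M (?t m) d'))"
    unfolding m by (simp add: simps)
  also have "\<dots> = class_sum M (class_sum M e b) (class_sum M d r)"
    unfolding n r_def by (simp add: simps)
  finally show ?thesis
    unfolding r using V by (blast intro: difference_relI)
qed

section \<open>Surjectivity of the inclusion of Grothendieck groups\<close>

text \<open>Phrased with isomorphism classes alone, so that both directions become computations in
  the commutative semigroup \<open>Vect M\<close>.\<close>

lemma K_inclusion_surj_iff: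
  fixes M :: "'m topology" and S :: "('m, 'k::real_normed_field) bundle_rep set set"
  assumes S: "S \<subseteq> Vect M"
    and triv: "\<And>n. trivial_class M n \<in> S"
    and sum: "\<And>a b. a \<in> S \<Longrightarrow> b \<in> S \<Longrightarrow> class_sum M a b \<in> S"
    and inv: "\<And>a. a \<in> S \<Longrightarrow> \<exists>b\<in>S. \<exists>n. class_sum M a b = trivial_class M n"
  shows "K_inclusion M ` carrier (K_group M S) = carrier (K_group M (Vect M)) \<longleftrightarrow>
    (\<forall>a\<in>Vect M. \<exists>k. class_sum M a (trivial_class M k) \<in> S)"
proof
  let ?t = "trivial_class M :: nat \<Rightarrow> ('m, 'k) bundle_rep set"
  assume surj: "K_inclusion M ` carrier (K_group M S) = carrier (K_group M (Vect M))"
  show "\<forall>a\<in>Vect M. \<exists>k. class_sum M a (?t k) \<in> S"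
  proof
    fix e :: "('m, 'k) bundle_rep set" assume e: "e \<in> Vect M"
    have "difference_rel M (Vect M) `` {(e, ?t 0)} \<in> K_inclusion M ` carrier (K_group M S)"
      unfolding surj using e trivial_class_in_Vect by (auto simp: K_group_def quotient_def)
    then obtain a b where ab: "a \<in> S" "b \<in> S"
      and eq: "difference_rel M (Vect M) `` {(e, ?t 0)} =
        difference_rel M (Vect M) `` (difference_rel M S `` {(a, b)})"
      by (auto simp: K_group_def quotient_def K_inclusion_def)
    \<comment> \<open>Reflexivity, used twice, places \<open>(a, b)\<close> in the right-hand set of
      \<open>eq\<close>, hence in the left-hand one. This compares the two classes without
      transitivity, which has not been derived in this direction.\<close>
    have "(a, b) \<in> difference_rel M (Vect M) `` (difference_rel M S `` {(a, b)})"
      using difference_rel_refl[of a S b M] difference_rel_refl[of a "Vect M" b M] ab S by blast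
    then have "((e, ?t 0), (a, b)) \<in> difference_rel M (Vect M)"
      unfolding eq[symmetric] by blast
    then obtain m where m: "class_sum M (class_sum M e b) (?t m) = class_sum M (class_sum M a (?t 0)) (?t m)"
      unfolding difference_rel_def by blast
    obtain b' n where b': "b' \<in> S" "class_sum M b b' = ?t n"
      using inv ab by blast
    have V: "a \<in> Vect M" "b \<in> Vect M" "b' \<in> Vect M" using ab b' S by auto
    note simps = class_sum_ac V e class_sum_closed trivial_class_in_Vect
    \<comment> \<open>The rank splits as \<open>n\<close> from the sum of \<open>b\<close> and
      \<open>b'\<close> plus the stabilisation \<open>m\<close>. By \<open>m\<close> the term
      \<open>e\<close> together with \<open>b\<close> can then be replaced by \<open>a\<close>,
      leaving only summands from \<open>S\<close>.\<close>
    have "class_sum M e (?t (n + m)) = class_sum M e (class_sum M (class_sum M b b') (?t m))"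
      unfolding b' class_sum_trivial ..
    also have "\<dots> = class_sum M (class_sum M (class_sum M e b) (?t m)) b'"
      by (simp add: simps)
    also have "\<dots> \<in> S" unfolding m using ab b' by (intro sum triv)
    finally show "\<exists>k. class_sum M e (?t k) \<in> S" by blast
  qed
next
  let ?t = "trivial_class M :: nat \<Rightarrow> ('m, 'k) bundle_rep set"
  let ?R = "difference_rel M (Vect M) :: (('m, 'k) bundle_rep set \<times> ('m, 'k) bundle_rep set) rel"
  assume stab: "\<forall>a\<in>Vect M. \<exists>k. class_sum M a (?t k) \<in> S"
  note simps = class_sum_ac class_sum_closed trivial_class_in_Vect
  have Vinv: "\<exists>b\<in>Vect M. \<exists>n. class_sum M a b = ?t n" if a: "a \<in> Vect M" for a
  proof -
    obtain k where k: "class_sum M a (?t k) \<in> S" using stab a by blast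
    then obtain b n where b: "b \<in> S" "class_sum M (class_sum M a (?t k)) b = ?t n"
      using inv by blast
    have bV: "b \<in> Vect M" using b(1) S by blast
    have "class_sum M a (class_sum M (?t k) b) = ?t n"
      using b(2) class_sum_assoc[OF a trivial_class_in_Vect bV] by simp
    then show ?thesis using class_sum_closed[OF trivial_class_in_Vect bV] by blast
  qed
  have "trans ?R"
  proof (rule transI)
    fix p q r assume pq: "(p, q) \<in> ?R" and qr: "(q, r) \<in> ?R"
    then have "snd q \<in> Vect M" unfolding difference_rel_def by auto
    then obtain d' l where "d' \<in> Vect M" "class_sum M (snd q) d' = ?t l" using Vinv by blast
    then show "(p, r) \<in> ?R"
      using difference_rel_trans[of "fst p" "snd p" "fst q" "snd q" M "fst r" "snd r"] pq qr by simp
  qed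
  then have R: "?R `` {p} = ?R `` {q}" if "(p, q) \<in> ?R" for p q
    using that sym_difference_rel[of M "Vect M"] unfolding sym_def trans_def by blast
  \<comment> \<open>\<open>K_inclusion\<close> forms the union of the classes in
    \<open>Vect M\<close> of all pairs related to \<open>(a, b)\<close> over \<open>S\<close>. By
    \<open>R\<close> these classes coincide, so the union is a single class.\<close>
  have incl: "K_inclusion M (difference_rel M S `` {(a, b)}) = ?R `` {(a, b)}"
    if "a \<in> S" "b \<in> S" for a b
  proof -
    have "((a, b), (a, b)) \<in> difference_rel M S" using that by (rule difference_rel_refl)
    moreover have "?R `` {q} = ?R `` {(a, b)}" if "((a, b), q) \<in> difference_rel M S" for q
      using R that difference_rel_mono[OF S] by blast
    ultimately show ?thesis unfolding K_inclusion_def by blast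
  qed
  show "K_inclusion M ` carrier (K_group M S) = carrier (K_group M (Vect M))"
  proof
    show "K_inclusion M ` carrier (K_group M S) \<subseteq> carrier (K_group M (Vect M))"
    proof
      fix P assume "P \<in> K_inclusion M ` carrier (K_group M S)"
      then obtain a b where "a \<in> S" "b \<in> S" "P = ?R `` {(a, b)}"
        by (auto simp: K_group_def quotient_def incl)
      then show "P \<in> carrier (K_group M (Vect M))"
        using S by (auto simp: K_group_def intro: quotientI)
    qed
    show "carrier (K_group M (Vect M)) \<subseteq> K_inclusion M ` carrier (K_group M S)"
    proof
      fix P assume "P \<in> carrier (K_group M (Vect M) :: (('m, 'k) bundle_rep set \<times> ('m, 'k) bundle_rep set) set monoid)"
      then obtain a b where V: "a \<in> Vect M" "b \<in> Vect M" and P: "P = ?R `` {(a, b)}"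
        by (auto simp: K_group_def quotient_def)
      obtain k l where kl: "class_sum M a (?t k) \<in> S" "class_sum M b (?t l) \<in> S"
        using stab V by meson
      define a' b' where "a' = class_sum M (class_sum M a (?t k)) (?t l)"
        and "b' = class_sum M (class_sum M b (?t l)) (?t k)"
      have S': "a' \<in> S" "b' \<in> S" unfolding a'_def b'_def using kl by (auto intro: sum triv)
      \<comment> \<open>Both sides consist of \<open>a\<close>, \<open>b\<close> and the trivial
        classes of ranks \<open>k\<close> and \<open>l\<close>; hence the two differences agree with
        stabilisation \<open>m = 0\<close>.\<close>
      have "class_sum M a b' = class_sum M a' b"
        unfolding a'_def b'_def using V by (simp add: simps)
      then have "((a, b), (a', b')) \<in> ?R"
        using V S' S by (intro difference_relI[where m = 0]) auto
      then have "P = K_inclusion M (difference_rel M S `` {(a', b')})"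
        using R S' P by (simp add: incl)
      then show "P \<in> K_inclusion M ` carrier (K_group M S)"
        using S' by (auto simp: K_group_def quotient_def)
    qed
  qed
qed

section \<open>From isomorphism classes back to bundles\<close>

text \<open>Elements of \<open>S\<close> are full isomorphism classes, so a bundle isomorphic to a
  member of one of them has that very class.\<close>

lemma class_sum_trivial_mem_iff:
  fixes E :: "('e, 'm, 'k::real_normed_field) vbundle"
  assumes S: "S \<subseteq> Vect M" and E: "vector_bundle M E"
  shows "class_sum M (bundle_class M E) (trivial_class M k) \<in> S \<longleftrightarrow>
    (\<exists>A\<in>\<Union>S. E \<oplus>\<^sub>V trivial_bundle M k \<cong>\<^sub>V A)"
proof -
  let ?E = "E \<oplus>\<^sub>V (trivial_bundle M k :: ('m, 'k) bundle_rep)"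
  have vb: "vector_bundle M ?E"
    by (rule vector_bundle_whitney_sum[OF E vector_bundle_trivial])
  have eq: "class_sum M (bundle_class M E) (trivial_class M k) = bundle_class M ?E"
    by (simp add: trivial_class_def class_sum_bundle_class E vector_bundle_trivial)
  have "a = bundle_class M ?E" if a: "a \<in> S" "A \<in> a" "?E \<cong>\<^sub>V A" for a A
  proof -
    from a(1) S have "a \<in> Vect M" by blast
    then obtain F :: "('m, 'k) bundle_rep" where F: "vector_bundle M F" "a = bundle_class M F"
      by (rule VectE)
    then have "F \<cong>\<^sub>V A" using a(2) by (simp add: bundle_class_def)
    then show ?thesis
      using F(2) bundle_class_eq[OF F(1)] bundle_class_eq[OF vb a(3)] by simp
  qed
  \<comment> \<open>The sum itself has a product type and cannot be the witness; a representative of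
    type \<open>bundle_rep\<close> takes its place.\<close>
  moreover have "\<exists>A\<in>bundle_class M ?E. ?E \<cong>\<^sub>V A"
    using vector_bundle_has_bundle_rep[OF vb] by (auto simp: bundle_class_def)
  ultimately show ?thesis unfolding eq by blast
qed

text \<open>Kept generic in the scalar type, so that the complex and the real case are two instances
  of one argument.\<close>

lemma K_inclusion_surj_iff_stably:
  fixes M :: "'m topology" and S :: "('m, 'k::real_normed_field) bundle_rep set set"
  assumes "S \<subseteq> Vect M" "\<forall>n. trivial_class M n \<in> S" "\<forall>a\<in>S. \<forall>b\<in>S. class_sum M a b \<in> S"
    "\<forall>a\<in>S. \<exists>b\<in>S. \<exists>n. class_sum M a b = trivial_class M n"
  shows "K_inclusion M ` carrier (K_group M S) = carrier (K_group M (Vect M)) \<longleftrightarrow>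
    (\<forall>E :: ('m, 'k) bundle_rep. vector_bundle M E \<longrightarrow>
       (\<exists>k. \<exists>A\<in>\<Union>S. E \<oplus>\<^sub>V trivial_bundle M k \<cong>\<^sub>V A))"
proof -
  have "K_inclusion M ` carrier (K_group M S) = carrier (K_group M (Vect M)) \<longleftrightarrow>
      (\<forall>a\<in>Vect M. \<exists>k. class_sum M a (trivial_class M k) \<in> S)"
    using assms by (intro K_inclusion_surj_iff) auto
  also have "\<dots> \<longleftrightarrow> (\<forall>E :: ('m, 'k) bundle_rep. vector_bundle M E \<longrightarrow>
       (\<exists>k. class_sum M (bundle_class M E) (trivial_class M k) \<in> S))"
    unfolding Vect_def by blast
  also have "\<dots> \<longleftrightarrow> (\<forall>E :: ('m, 'k) bundle_rep. vector_bundle M E \<longrightarrow>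
       (\<exists>k. \<exists>A\<in>\<Union>S. E \<oplus>\<^sub>V trivial_bundle M k \<cong>\<^sub>V A))"
    using class_sum_trivial_mem_iff[OF assms(1)] by metis
  finally show ?thesis .
qed

theorem proposition1p6:
  fixes M :: "'m topology"
  assumes "closed_manifold M"
  shows
    "(\<forall>S :: ('m, complex) bundle_rep set set.
        S \<subseteq> Vect M \<longrightarrow>
        (\<forall>n. trivial_class M n \<in> S) \<longrightarrow>
        (\<forall>a\<in>S. \<forall>b\<in>S. class_sum M a b \<in> S) \<longrightarrow>
        (\<forall>a\<in>S. \<exists>b\<in>S. \<exists>n. class_sum M a b = trivial_class M n) \<longrightarrow>
        (K_inclusion M ` carrier (K_group M S) = carrier (K_group M (Vect M)) \<longleftrightarrow>
         (\<forall>E :: ('m, complex) bundle_rep. vector_bundle M E \<longrightarrow>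
            (\<exists>k. \<exists>A\<in>\<Union>S. E \<oplus>\<^sub>V trivial_bundle M k \<cong>\<^sub>V A)))) \<and>
     (\<forall>S :: ('m, real) bundle_rep set set.
        S \<subseteq> Vect M \<longrightarrow>
        (\<forall>n. trivial_class M n \<in> S) \<longrightarrow>
        (\<forall>a\<in>S. \<forall>b\<in>S. class_sum M a b \<in> S) \<longrightarrow>
        (\<forall>a\<in>S. \<exists>b\<in>S. \<exists>n. class_sum M a b = trivial_class M n) \<longrightarrow>
        (K_inclusion M ` carrier (K_group M S) = carrier (K_group M (Vect M)) \<longleftrightarrow>
         (\<forall>E :: ('m, real) bundle_rep. vector_bundle M E \<longrightarrow>
            (\<exists>k. \<exists>A\<in>\<Union>S. E \<oplus>\<^sub>V trivial_bundle M k \<cong>\<^sub>V A))))"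
  by (intro conjI allI impI; rule K_inclusion_surj_iff_stably; assumption)

end
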